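(* For all $\theta,\theta'\in\Theta=\nu\,\mathbb{C}[[\nu]]$ the following identity holds in $H\otimes H\otimes H$, where $H=\mathcal{U}(\mathfrak{h}_3(\mathbb{R}))[[\nu]]$: $$(\Delta\otimes\mathrm{id})\big(F_\theta^{-1}\big)\big(F_{\theta'}^{-1}\otimes 1\big)=(\mathrm{id}\otimes\Delta)\big(F_{\theta'}^{-1}\big)\big(1\otimes F_\theta^{-1}\big)\,\Phi_{\theta,\theta'},$$ where $$\Phi_{\theta,\theta'}:=\exp\big\{-\mathfrak{p}\otimes(\theta-\theta'-\theta\theta'\,\mathfrak{t})\otimes\mathfrak{q}\big\}.$$
   Context: $\mathfrak{h}_3(\mathbb{R})$ is the 3-dimensional Heisenberg Lie algebra with basis $\mathfrak{p},\mathfrak{q},\mathfrak{t}$, where $\mathfrak{t}$ is central and $[\mathfrak{p},\mathfrak{q}]=\mathfrak{t}$. $\mathcal{U}(\mathfrak{h}_3(\mathbb{R}))$ is its universal enveloping algebra (with complex coefficients) with the standard Hopf algebra structure, so that $\Delta(X)=X\otimes 1+1\otimes X$ for $X\in\{\mathfrak{p},\mathfrak{q},\mathfrak{t}\}$. $H=\mathcal{U}(\mathfrak{h}_3(\mathbb{R}))[[\nu]]$ is the corresponding topological Hopf algebra over $\mathbb{C}[[\nu]]$; all tensor products are over $\mathbb{C}[[\nu]]$ and completed in the $\nu$-adic topology, and $\Delta$ is extended $\mathbb{C}[[\nu]]$-linearly and continuously. $\Theta:=\nu\,\mathbb{C}[[\nu]]$ is the set of formal power series without constant term. For $\theta\in\Theta$,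 $F_\theta:=\exp\{\theta\,\mathfrak{p}\otimes\mathfrak{q}\}\in H\otimes H$ (formal exponential series), which is invertible with $F_\theta^{-1}=\exp\{-\theta\,\mathfrak{p}\otimes\mathfrak{q}\}$. *)

theory Defs
  imports
    Complex_Main
    "HOL-Library.Poly_Mapping"
    "HOL-Computational_Algebra.Formal_Power_Series"
begin

section \<open>Complex vector spaces and unital complex algebras\<close>

class complex_vector = ab_group_add +
  fixes scaleC :: "complex \<Rightarrow> 'a \<Rightarrow> 'a"  (infixr \<open>*\<^sub>C\<close> 75)
  assumes scaleC_add_right: "c *\<^sub>C (x + y) = c *\<^sub>C x + c *\<^sub>C y"
    and scaleC_add_left: "(c + d) *\<^sub>C x = c *\<^sub>C x + d *\<^sub>C x"
    and scaleC_scaleC [simp]: "c *\<^sub>C d *\<^sub>C x = (c * d) *\<^sub>C x"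
    and scaleC_one [simp]: "1 *\<^sub>C x = x"

class complex_algebra_1 = complex_vector + ring_1 +
  assumes mult_scaleC_left: "(c *\<^sub>C x) * y = c *\<^sub>C (x * y)"
    and mult_scaleC_right: "x * (c *\<^sub>C y) = c *\<^sub>C (x * y)"

interpretation cvec: vector_space "scaleC :: complex \<Rightarrow> 'a \<Rightarrow> 'a::complex_vector"
  by standard (simp_all add: scaleC_add_right scaleC_add_left)

abbreviation clinear :: "('a::complex_vector \<Rightarrow> 'b::complex_vector) \<Rightarrow> bool"
  where "clinear \<equiv> Vector_Spaces.linear scaleC scaleC"

definition cbilinear :: "('a::complex_vector \<Rightarrow> 'b::complex_vector \<Rightarrow> 'c::complex_vector) \<Rightarrow> bool"
  where "cbilinear h \<longleftrightarrow> (\<forall>a. clinear (h a)) \<and> (\<forall>b. clinear (\<lambda>a. h a b))"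

lemma clinearI:
  assumes "\<And>x y. f (x + y) = f x + f y" "\<And>c x. f (c *\<^sub>C x) = c *\<^sub>C f x"
  shows "clinear f"
  by (intro Vector_Spaces.linear.intro module_hom.intro module_hom_axioms.intro
        cvec.vector_space_axioms cvec.module_axioms assms)

lemma clinearD:
  assumes "clinear f"
  shows "f (x + y) = f x + f y" "f (c *\<^sub>C x) = c *\<^sub>C f x" "f 0 = 0" "f (x - y) = f x - f y"
    "f (- x) = - f x" "f (sum g A) = (\<Sum>i\<in>A. f (g i))"
proof -
  interpret Vector_Spaces.linear scaleC scaleC f by fact
  show "f (x + y) = f x + f y" "f (c *\<^sub>C x) = c *\<^sub>C f x" "f 0 = 0" "f (x - y) = f x - f y"
    "f (- x) = - f x" "f (sum g A) = (\<Sum>i\<in>A. f (g i))"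
    by (rule add scale zero diff neg sum)+
qed

lemma cbilinearI:
  assumes "\<And>a a' b. h (a + a') b = h a b + h a' b" "\<And>c a b. h (c *\<^sub>C a) b = c *\<^sub>C h a b"
    "\<And>a b b'. h a (b + b') = h a b + h a b'" "\<And>c a b. h a (c *\<^sub>C b) = c *\<^sub>C h a b"
  shows "cbilinear h"
  unfolding cbilinear_def by (intro conjI allI clinearI assms)

lemma cbilinear_clinear:
  assumes "cbilinear h"
  shows "clinear (h a)" "clinear (\<lambda>a. h a b)"
  using assms by (auto simp: cbilinear_def)

instantiation complex :: complex_algebra_1
begin
definition scaleC_complex :: "complex \<Rightarrow> complex \<Rightarrow> complex"
  where "scaleC_complex c x = c * x"
instance by standard (simp_all add: scaleC_complex_def algebra_simps)
end

instantiation poly_mapping :: (type, complex_vector) complex_vector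
begin
definition scaleC_poly_mapping :: "complex \<Rightarrow> ('a \<Rightarrow>\<^sub>0 'b) \<Rightarrow> 'a \<Rightarrow>\<^sub>0 'b"
  where "scaleC_poly_mapping c = Poly_Mapping.map (scaleC c)"
lemma lookup_scaleC [simp]:
  "Poly_Mapping.lookup (c *\<^sub>C p) k = c *\<^sub>C Poly_Mapping.lookup p k"
  unfolding scaleC_poly_mapping_def by (simp add: map.rep_eq when_def)
instance
  by standard (simp_all add: poly_mapping_eq_iff fun_eq_iff lookup_add scaleC_add_right
      scaleC_add_left)
end

instantiation fps :: (complex_vector) complex_vector
begin
definition scaleC_fps :: "complex \<Rightarrow> 'a fps \<Rightarrow> 'a fps"
  where "scaleC_fps c X = Abs_fps (\<lambda>n. c *\<^sub>C fps_nth X n)"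
lemma fps_nth_scaleC [simp]: "fps_nth (c *\<^sub>C X) n = c *\<^sub>C fps_nth X n"
  by (simp add: scaleC_fps_def)
instance
  by standard (simp_all add: fps_eq_iff scaleC_add_right scaleC_add_left)
end

instance fps :: (complex_algebra_1) complex_algebra_1
  by standard (simp_all add: fps_eq_iff fps_mult_nth mult_scaleC_left mult_scaleC_right
      cvec.scale_sum_right)


section \<open>Linear extension from a basis\<close>

definition lin_ext :: "('k \<Rightarrow> 'a::complex_vector) \<Rightarrow> ('k \<Rightarrow>\<^sub>0 complex) \<Rightarrow> 'a"
  where "lin_ext f P = (\<Sum>k\<in>Poly_Mapping.keys P. Poly_Mapping.lookup P k *\<^sub>C f k)"

lemma lin_ext_superset:
  assumes "finite A" "Poly_Mapping.keys P \<subseteq> A"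
  shows "lin_ext f P = (\<Sum>k\<in>A. Poly_Mapping.lookup P k *\<^sub>C f k)"
  unfolding lin_ext_def using assms
  by (intro sum.mono_neutral_left) (auto simp: in_keys_iff)

lemma clinear_lin_ext: "clinear (lin_ext f)"
proof (rule clinearI)
  fix P Q :: "'a \<Rightarrow>\<^sub>0 complex" and c
  let ?A = "Poly_Mapping.keys P \<union> Poly_Mapping.keys Q"
  show "lin_ext f (P + Q) = lin_ext f P + lin_ext f Q"
    using Poly_Mapping.keys_add[of P Q]
    by (subst (1 2 3) lin_ext_superset[of ?A])
      (auto simp: lookup_add scaleC_add_left sum.distrib)
  have "Poly_Mapping.keys (c *\<^sub>C P) \<subseteq> Poly_Mapping.keys P"
    by (auto simp: in_keys_iff)
  then show "lin_ext f (c *\<^sub>C P) = c *\<^sub>C lin_ext f P"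
    by (subst (1 2) lin_ext_superset[of "Poly_Mapping.keys P"])
      (auto simp: scaleC_complex_def cvec.scale_sum_right)
qed

lemma lin_ext_single [simp]: "lin_ext f (Poly_Mapping.single k c) = c *\<^sub>C f k"
  by (subst lin_ext_superset[of "{k}"]) auto

lemma poly_mapping_expand:
  fixes P :: "'k \<Rightarrow>\<^sub>0 'a::comm_monoid_add"
  shows "P = (\<Sum>k\<in>Poly_Mapping.keys P. Poly_Mapping.single k (Poly_Mapping.lookup P k))"
  by (rule poly_mapping_eqI)
    (auto simp: lookup_sum lookup_single when_def in_keys_iff)

lemma poly_mapping_lin_induct [case_names zero single add]:
  fixes P :: "'k \<Rightarrow>\<^sub>0 'a::comm_monoid_add"
  assumes "Q 0" "\<And>k c. Q (Poly_Mapping.single k c)" "\<And>P P'. Q P \<Longrightarrow> Q P' \<Longrightarrow> Q (P + P')"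
  shows "Q P"
proof -
  have "Q (\<Sum>k\<in>A. Poly_Mapping.single k (Poly_Mapping.lookup P k))" if "finite A" for A
    using that by (induction A) (auto intro: assms)
  then show ?thesis
    by (subst poly_mapping_expand) simp
qed


section \<open>The tensor product over the complex numbers\<close>

inductive_set tensor_null ::
    "('a::complex_vector \<times> 'b::complex_vector \<Rightarrow>\<^sub>0 complex) set"
  where
    "Poly_Mapping.single (a + a', b) 1 - Poly_Mapping.single (a, b) 1
      - Poly_Mapping.single (a', b) 1 \<in> tensor_null"
  | "Poly_Mapping.single (a, b + b') 1 - Poly_Mapping.single (a, b) 1
      - Poly_Mapping.single (a, b') 1 \<in> tensor_null"
  | "Poly_Mapping.single (c *\<^sub>C a, b) 1 - c *\<^sub>C Poly_Mapping.single (a, b) 1 \<in> tensor_null"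
  | "Poly_Mapping.single (a, c *\<^sub>C b) 1 - c *\<^sub>C Poly_Mapping.single (a, b) 1 \<in> tensor_null"
  | null_add: "x \<in> tensor_null \<Longrightarrow> y \<in> tensor_null \<Longrightarrow> x + y \<in> tensor_null"
  | null_scale: "x \<in> tensor_null \<Longrightarrow> c *\<^sub>C x \<in> tensor_null"

lemma null_zero: "0 \<in> tensor_null"
  using null_scale[OF tensor_null.intros(1), of 0] by simp

lemma null_uminus: "x \<in> tensor_null \<Longrightarrow> - x \<in> tensor_null"
  using null_scale[of x "-1"] by simp

lemma null_diff: "x \<in> tensor_null \<Longrightarrow> y \<in> tensor_null \<Longrightarrow> x - y \<in> tensor_null"
  using null_add[of x "- y"] null_uminus[of y] by simp

quotient_type (overloaded) ('a, 'b) tensor =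
  "'a::complex_vector \<times> 'b::complex_vector \<Rightarrow>\<^sub>0 complex" / "\<lambda>x y. x - y \<in> tensor_null"
proof (rule equivpI)
  show "reflp (\<lambda>x y :: 'a \<times> 'b \<Rightarrow>\<^sub>0 complex. x - y \<in> tensor_null)"
    by (auto simp: reflp_def null_zero)
  show "symp (\<lambda>x y :: 'a \<times> 'b \<Rightarrow>\<^sub>0 complex. x - y \<in> tensor_null)"
    using null_uminus by (fastforce simp: symp_def)
  show "transp (\<lambda>x y :: 'a \<times> 'b \<Rightarrow>\<^sub>0 complex. x - y \<in> tensor_null)"
    using null_add by (fastforce simp: transp_def)
qed

instantiation tensor :: (complex_vector, complex_vector) complex_vector
begin
lift_definition zero_tensor :: "('a, 'b) tensor" is 0 .
lift_definition plus_tensor :: "('a, 'b) tensor \<Rightarrow> ('a, 'b) tensor \<Rightarrow> ('a, 'b) tensor" is "(+)"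
  using null_add by (metis add_diff_add)
lift_definition uminus_tensor :: "('a, 'b) tensor \<Rightarrow> ('a, 'b) tensor" is "uminus"
  using null_uminus by (metis minus_diff_minus)
lift_definition minus_tensor :: "('a, 'b) tensor \<Rightarrow> ('a, 'b) tensor \<Rightarrow> ('a, 'b) tensor" is "(-)"
  using null_diff by (metis (no_types, lifting) add_diff_add diff_conv_add_uminus minus_diff_minus)
lift_definition scaleC_tensor :: "complex \<Rightarrow> ('a, 'b) tensor \<Rightarrow> ('a, 'b) tensor" is "scaleC"
  using null_scale by (metis cvec.scale_right_diff_distrib)
instance
  by standard (transfer; simp add: null_zero scaleC_add_right scaleC_add_left add_ac)+
end

lift_definition pure :: "'a::complex_vector \<Rightarrow> 'b::complex_vector \<Rightarrow> ('a, 'b) tensor"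
    (infixr \<open>\<otimes>\<close> 72)
  is "\<lambda>a b. Poly_Mapping.single (a, b) 1" .

lemma cbilinear_pure: "cbilinear (\<otimes>)"
proof (rule cbilinearI)
  show "(a + a') \<otimes> b = a \<otimes> b + a' \<otimes> b" for a a' :: 'a and b :: 'b
    by transfer (use tensor_null.intros(1) in \<open>simp add: diff_diff_eq\<close>)
  show "a \<otimes> (b + b') = a \<otimes> b + a \<otimes> b'" for a :: 'a and b b' :: 'b
    by transfer (use tensor_null.intros(2) in \<open>simp add: diff_diff_eq\<close>)
  show "(c *\<^sub>C a) \<otimes> b = c *\<^sub>C (a \<otimes> b)" for c and a :: 'a and b :: 'b
    by transfer (rule tensor_null.intros)
  show "a \<otimes> (c *\<^sub>C b) = c *\<^sub>C (a \<otimes> b)" for c and a :: 'a and b :: 'b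
    by transfer (rule tensor_null.intros)
qed

lemmas clinear_pure = cbilinear_clinear[OF cbilinear_pure]
lemmas pure_simps = clinearD[OF clinear_pure(1)] clinearD[OF clinear_pure(2)]

lemma abs_tensor_single: "abs_tensor (Poly_Mapping.single (a, b) c) = c *\<^sub>C (a \<otimes> b)"
proof -
  have "Poly_Mapping.single (a, b) c = c *\<^sub>C Poly_Mapping.single (a, b) 1"
    by (rule poly_mapping_eqI) (simp add: lookup_single when_def scaleC_complex_def)
  then show ?thesis
    by (simp add: pure.abs_eq scaleC_tensor.abs_eq)
qed

lemma tensor_induct [case_names pure add, induct type: tensor]:
  assumes "\<And>a b. P (a \<otimes> b)" "\<And>x y. P x \<Longrightarrow> P y \<Longrightarrow> P (x + y)"
  shows "P t"
proof (induction t rule: tensor.abs_induct)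
  case (1 y)
  show ?case
  proof (induction y rule: poly_mapping_lin_induct)
    case zero
    have "P (0 \<otimes> 0)" by (rule assms)
    then show ?case by (simp add: pure_simps flip: zero_tensor_def)
  next
    case (single k c)
    have "P ((c *\<^sub>C fst k) \<otimes> snd k)" by (rule assms)
    then show ?case by (cases k) (simp add: pure_simps abs_tensor_single)
  next
    case (add p q)
    then show ?case using assms(2) by (simp flip: plus_tensor.abs_eq)
  qed
qed

text \<open>The linear map induced by a bilinear one.  The value on a chosen representative is
  independent of that choice for bilinear \<open>h\<close>, and the definition is used for no other \<open>h\<close>.\<close>

definition tensor_lift ::
    "('a::complex_vector \<Rightarrow> 'b::complex_vector \<Rightarrow> 'c::complex_vector) \<Rightarrow> ('a, 'b) tensor \<Rightarrow> 'c"
  where "tensor_lift h t = lin_ext (\<lambda>(a, b). h a b) (rep_tensor t)"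

lemma tensor_lift_add:
  "tensor_lift (\<lambda>a b. h a b + k a b) t = tensor_lift h t + tensor_lift k t"
  by (simp add: tensor_lift_def lin_ext_def case_prod_beta scaleC_add_right sum.distrib)

lemma tensor_lift_scaleC: "tensor_lift (\<lambda>a b. c *\<^sub>C h a b) t = c *\<^sub>C tensor_lift h t"
  by (simp add: tensor_lift_def lin_ext_def case_prod_beta cvec.scale_sum_right mult.commute)

lemma lin_ext_null:
  assumes "cbilinear h" "x \<in> tensor_null"
  shows "lin_ext (\<lambda>(a, b). h a b) x = 0"
proof -
  note h = clinearD[OF cbilinear_clinear(1)[OF assms(1)]]
    clinearD[OF cbilinear_clinear(2)[OF assms(1)]]
  show ?thesis
    using assms(2) by induction (simp_all add: clinearD[OF clinear_lin_ext] h)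
qed

lemma tensor_lift_abs:
  assumes "cbilinear h"
  shows "tensor_lift h (abs_tensor x) = lin_ext (\<lambda>(a, b). h a b) x"
proof -
  have "rep_tensor (abs_tensor x) - x \<in> tensor_null"
    using Quotient3_rep_abs[OF Quotient3_tensor, of x] null_zero by simp
  from lin_ext_null[OF assms this] show ?thesis
    by (simp add: tensor_lift_def clinearD[OF clinear_lin_ext])
qed

lemma tensor_lift_pure [simp]: "cbilinear h \<Longrightarrow> tensor_lift h (a \<otimes> b) = h a b"
  by (simp add: pure.abs_eq tensor_lift_abs)

lemma clinear_tensor_lift:
  assumes "cbilinear h"
  shows "clinear (tensor_lift h)"
proof (rule clinearI)
  show "tensor_lift h (x + y) = tensor_lift h x + tensor_lift h y" for x y
    by (induction x rule: tensor.abs_induct, induction y rule: tensor.abs_induct)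
      (simp add: plus_tensor.abs_eq tensor_lift_abs assms clinearD[OF clinear_lin_ext])
  show "tensor_lift h (c *\<^sub>C x) = c *\<^sub>C tensor_lift h x" for c x
    by (induction x rule: tensor.abs_induct)
      (simp add: scaleC_tensor.abs_eq tensor_lift_abs assms clinearD[OF clinear_lin_ext])
qed

lemma clinear_eq_on_pure:
  assumes "clinear f" "clinear g" "\<And>a b. f (a \<otimes> b) = g (a \<otimes> b)"
  shows "f t = g t"
  by (induction t) (simp_all add: assms clinearD(1)[OF assms(1)] clinearD(1)[OF assms(2)])

definition tensor_map ::
    "('a::complex_vector \<Rightarrow> 'c::complex_vector) \<Rightarrow> ('b::complex_vector \<Rightarrow> 'd::complex_vector)
      \<Rightarrow> ('a, 'b) tensor \<Rightarrow> ('c, 'd) tensor"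
  where "tensor_map f g = tensor_lift (\<lambda>a b. f a \<otimes> g b)"

definition tensor_assoc ::
    "(('a::complex_vector, 'b::complex_vector) tensor, 'c::complex_vector) tensor
      \<Rightarrow> ('a, ('b, 'c) tensor) tensor"
  where "tensor_assoc = tensor_lift (\<lambda>x c. tensor_lift (\<lambda>a b. a \<otimes> b \<otimes> c) x)"

lemma cbilinear_tensor_map:
  "clinear f \<Longrightarrow> clinear g \<Longrightarrow> cbilinear (\<lambda>a b. f a \<otimes> g b)"
  by (intro cbilinearI) (simp_all add: clinearD pure_simps)

lemma cbilinear_assoc_inner: "cbilinear (\<lambda>a b. a \<otimes> b \<otimes> c)"
  by (intro cbilinearI) (simp_all add: pure_simps)

lemma cbilinear_assoc: "cbilinear (\<lambda>x c. tensor_lift (\<lambda>a b. a \<otimes> b \<otimes> c) x)"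
proof (rule cbilinearI)
  note lin = clinear_tensor_lift[OF cbilinear_assoc_inner]
  fix x y :: "('a, 'b) tensor" and c d :: 'c and k
  show "tensor_lift (\<lambda>a b. a \<otimes> b \<otimes> c) (x + y) =
      tensor_lift (\<lambda>a b. a \<otimes> b \<otimes> c) x + tensor_lift (\<lambda>a b. a \<otimes> b \<otimes> c) y"
    by (rule clinearD[OF lin])
  show "tensor_lift (\<lambda>a b. a \<otimes> b \<otimes> c) (k *\<^sub>C x) = k *\<^sub>C tensor_lift (\<lambda>a b. a \<otimes> b \<otimes> c) x"
    by (rule clinearD[OF lin])
  show "tensor_lift (\<lambda>a b. a \<otimes> b \<otimes> (c + d)) x =
      tensor_lift (\<lambda>a b. a \<otimes> b \<otimes> c) x + tensor_lift (\<lambda>a b. a \<otimes> b \<otimes> d) x"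
    by (simp add: pure_simps tensor_lift_add)
  show "tensor_lift (\<lambda>a b. a \<otimes> b \<otimes> (k *\<^sub>C c)) x = k *\<^sub>C tensor_lift (\<lambda>a b. a \<otimes> b \<otimes> c) x"
    by (simp add: pure_simps tensor_lift_scaleC)
qed

lemma tensor_map_pure [simp]:
  "clinear f \<Longrightarrow> clinear g \<Longrightarrow> tensor_map f g (a \<otimes> b) = f a \<otimes> g b"
  by (simp add: tensor_map_def cbilinear_tensor_map)

lemma tensor_assoc_pure [simp]: "tensor_assoc ((a \<otimes> b) \<otimes> c) = a \<otimes> b \<otimes> c"
  by (simp add: tensor_assoc_def cbilinear_assoc cbilinear_assoc_inner)

lemma clinear_tensor_map: "clinear f \<Longrightarrow> clinear g \<Longrightarrow> clinear (tensor_map f g)"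
  unfolding tensor_map_def by (intro clinear_tensor_lift cbilinear_tensor_map)

lemma clinear_tensor_assoc: "clinear tensor_assoc"
  unfolding tensor_assoc_def by (intro clinear_tensor_lift cbilinear_assoc)

lemma ex_clinear_functional:
  fixes v :: "'a::complex_vector"
  assumes "v \<noteq> 0"
  obtains f :: "'a \<Rightarrow> complex" where "clinear f" "f v = 1"
proof -
  interpret vs: vector_space_pair "scaleC :: complex \<Rightarrow> 'a \<Rightarrow> 'a"
    "scaleC :: complex \<Rightarrow> complex \<Rightarrow> complex" ..
  have "cvec.independent {v}"
    using assms by simp
  from vs.linear_independent_extend[OF this, of "\<lambda>_. 1"] that show ?thesis
    by auto
qed

instantiation tensor :: (complex_algebra_1, complex_algebra_1) complex_algebra_1
begin
definition one_tensor :: "('a, 'b) tensor"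
  where "1 = 1 \<otimes> 1"
definition times_tensor :: "('a, 'b) tensor \<Rightarrow> ('a, 'b) tensor \<Rightarrow> ('a, 'b) tensor"
  where "x * y = tensor_lift (\<lambda>a b. tensor_lift (\<lambda>c d. (a * c) \<otimes> (b * d)) y) x"

lemma cbilinear_times_inner: "cbilinear (\<lambda>c d. (a * c) \<otimes> (b * d :: 'b))" for a :: 'a and b :: 'b
  by (intro cbilinearI) (simp_all add: pure_simps distrib_left mult_scaleC_right)

lemma cbilinear_times_outer:
  "cbilinear (\<lambda>a b. tensor_lift (\<lambda>c d. (a * c) \<otimes> (b * d)) y)" for y :: "('a, 'b) tensor"
proof -
  note lin = clinearD[OF clinear_tensor_lift[OF cbilinear_times_inner]]
  show ?thesis
    by (rule cbilinearI)
      (simp_all add: pure_simps lin distrib_right mult_scaleC_left tensor_lift_add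
        tensor_lift_scaleC)
qed

lemma pure_times: "(a \<otimes> b) * y = tensor_lift (\<lambda>c d. (a * c) \<otimes> (b * d)) y"
  for a :: 'a and b :: 'b
  unfolding times_tensor_def by (rule tensor_lift_pure[OF cbilinear_times_outer])

lemma pure_times_pure [simp]: "(a \<otimes> b) * (c \<otimes> d) = (a * c) \<otimes> (b * d)"
  for a c :: 'a and b d :: 'b
  by (simp add: pure_times cbilinear_times_inner)

lemma tensor_distrib_right: "(x + y) * z = x * z + y * z" for x y z :: "('a, 'b) tensor"
  unfolding times_tensor_def
  by (rule clinearD[OF clinear_tensor_lift[OF cbilinear_times_outer]])

lemma tensor_scaleC_left: "(c *\<^sub>C x) * y = c *\<^sub>C (x * y)" for x y :: "('a, 'b) tensor"
  unfolding times_tensor_def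
  by (rule clinearD[OF clinear_tensor_lift[OF cbilinear_times_outer]])

lemma tensor_pure_distrib_left: "(a \<otimes> b) * (y + z) = (a \<otimes> b) * y + (a \<otimes> b) * z"
  for a :: 'a and b :: 'b
  by (simp add: pure_times
      clinearD[OF clinear_tensor_lift[OF cbilinear_times_inner]])

lemma tensor_pure_scaleC_right: "(a \<otimes> b) * (c *\<^sub>C y) = c *\<^sub>C ((a \<otimes> b) * y)"
  for a :: 'a and b :: 'b
  by (simp add: pure_times
      clinearD[OF clinear_tensor_lift[OF cbilinear_times_inner]])

lemma tensor_distrib_left: "x * (y + z) = x * y + x * z" for x y z :: "('a, 'b) tensor"
  by (induction x) (simp_all add: tensor_pure_distrib_left tensor_distrib_right add_ac)

instance
proof
  fix x y z :: "('a, 'b) tensor" and c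
  show "(x * y) * z = x * (y * z)"
  proof (induction x)
    case (pure a b)
    show ?case
    proof (induction y)
      case (pure c d)
      show ?case
        by (induction z) (simp_all add: mult.assoc tensor_distrib_left)
    qed (simp add: tensor_distrib_left tensor_distrib_right)
  qed (simp add: tensor_distrib_right)
  show "1 * x = x"
    by (induction x) (simp_all add: one_tensor_def tensor_distrib_left)
  show "x * 1 = x"
    by (induction x) (simp_all add: one_tensor_def tensor_distrib_right)
  show "(x + y) * z = x * z + y * z" by (rule tensor_distrib_right)
  show "x * (y + z) = x * y + x * z" by (rule tensor_distrib_left)
  show "(c *\<^sub>C x) * y = c *\<^sub>C (x * y)" by (rule tensor_scaleC_left)
  show "x * (c *\<^sub>C y) = c *\<^sub>C (x * y)"
    by (induction x)
      (simp_all add: tensor_pure_scaleC_right tensor_distrib_right scaleC_add_right)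
  obtain f :: "'a \<Rightarrow> complex" where f: "clinear f" "f 1 = 1"
    using ex_clinear_functional[of "1 :: 'a"] by auto
  obtain g :: "'b \<Rightarrow> complex" where g: "clinear g" "g 1 = 1"
    using ex_clinear_functional[of "1 :: 'b"] by auto
  have bil: "cbilinear (\<lambda>a b. f a * g b)"
    by (intro cbilinearI) (simp_all add: clinearD[OF f(1)] clinearD[OF g(1)] algebra_simps
        scaleC_complex_def)
  have "tensor_lift (\<lambda>a b. f a * g b) (1 :: ('a, 'b) tensor) = 1"
    by (simp add: one_tensor_def bil f g)
  moreover have "tensor_lift (\<lambda>a b. f a * g b) (0 :: ('a, 'b) tensor) = 0"
    by (rule clinearD[OF clinear_tensor_lift[OF bil]])
  ultimately show "(0 :: ('a, 'b) tensor) \<noteq> 1"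
    by auto
qed
end


section \<open>The free unital complex algebra on a set of letters\<close>

datatype 'x free_word = Word (letters: "'x list")

instantiation free_word :: (type) monoid_add
begin
definition zero_free_word :: "'a free_word"
  where "0 = Word []"
definition plus_free_word :: "'a free_word \<Rightarrow> 'a free_word \<Rightarrow> 'a free_word"
  where "u + v = Word (letters u @ letters v)"
instance
  by standard (simp_all add: zero_free_word_def plus_free_word_def)
end

text \<open>Words are written additively because \<^theory>\<open>HOL-Library.Poly_Mapping\<close> provides the
  convolution product for additively written monoids of exponents.\<close>

type_synonym 'x free_algebra = "'x free_word \<Rightarrow>\<^sub>0 complex"

definition gen :: "'x \<Rightarrow> 'x free_algebra"
  where "gen x = Poly_Mapping.single (Word [x]) 1"

instance poly_mapping :: (monoid_add, complex_algebra_1) complex_algebra_1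
proof
  have scaleC_single: "c *\<^sub>C Poly_Mapping.single k d = Poly_Mapping.single k (c *\<^sub>C d)"
    for c k and d :: 'b
    by (rule poly_mapping_eqI) (simp add: lookup_single when_def)
  fix x y :: "'a \<Rightarrow>\<^sub>0 'b" and c
  show "c *\<^sub>C x * y = c *\<^sub>C (x * y)"
  proof (induction x rule: poly_mapping_lin_induct)
    case (single k d)
    show ?case
      by (induction y rule: poly_mapping_lin_induct)
        (simp_all add: scaleC_single mult_single mult_scaleC_left distrib_left scaleC_add_right)
  qed (simp_all add: distrib_right scaleC_add_right)
  show "x * c *\<^sub>C y = c *\<^sub>C (x * y)"
  proof (induction x rule: poly_mapping_lin_induct)
    case (single k d)
    show ?case
      by (induction y rule: poly_mapping_lin_induct)
        (simp_all add: scaleC_single mult_single mult_scaleC_right distrib_left scaleC_add_right)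
  qed (simp_all add: distrib_right scaleC_add_right)
qed

definition free_eval :: "('x \<Rightarrow> 'a::complex_algebra_1) \<Rightarrow> 'x free_algebra \<Rightarrow> 'a"
  where "free_eval \<phi> = lin_ext (\<lambda>w. prod_list (map \<phi> (letters w)))"

lemma clinear_free_eval: "clinear (free_eval \<phi>)"
  unfolding free_eval_def by (rule clinear_lin_ext)

lemmas free_eval_simps = clinearD[OF clinear_free_eval]

lemma free_eval_single:
  "free_eval \<phi> (Poly_Mapping.single w c) = c *\<^sub>C prod_list (map \<phi> (letters w))"
  by (simp add: free_eval_def)

lemma free_eval_gen [simp]: "free_eval \<phi> (gen x) = \<phi> x"
  by (simp add: gen_def free_eval_single)

lemma free_eval_one [simp]: "free_eval \<phi> 1 = 1"
  using free_eval_single[of \<phi> 0 1] unfolding single_one by (simp add: zero_free_word_def)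

lemma free_eval_mult: "free_eval \<phi> (x * y) = free_eval \<phi> x * free_eval \<phi> y"
proof (induction x rule: poly_mapping_lin_induct)
  case (single k c)
  show ?case
    by (induction y rule: poly_mapping_lin_induct)
      (simp_all add: mult_single free_eval_single plus_free_word_def mult_scaleC_left
        mult_scaleC_right distrib_left free_eval_simps mult.commute)
qed (simp_all add: distrib_right free_eval_simps)


section \<open>Universal enveloping algebras\<close>

class real_lie_algebra = real_vector +
  fixes lie_bracket :: "'a \<Rightarrow> 'a \<Rightarrow> 'a"
  assumes bracket_add_left: "lie_bracket (x + y) z = lie_bracket x z + lie_bracket y z"
    and bracket_add_right: "lie_bracket x (y + z) = lie_bracket x y + lie_bracket x z"
    and bracket_scaleR_left: "lie_bracket (r *\<^sub>R x) y = r *\<^sub>R lie_bracket x y"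
    and bracket_scaleR_right: "lie_bracket x (r *\<^sub>R y) = r *\<^sub>R lie_bracket x y"
    and bracket_self: "lie_bracket x x = 0"
    and jacobi: "lie_bracket x (lie_bracket y z) + lie_bracket y (lie_bracket z x)
      + lie_bracket z (lie_bracket x y) = 0"

text \<open>The enveloping algebra with complex coefficients of a real Lie algebra.  The first two
  families of relators make the passage from the free algebra on the \<^emph>\<open>set\<close> \<open>'g\<close> to the complex
  tensor algebra of the vector space \<open>'g\<close>; the third is the enveloping relation.\<close>

inductive_set uea_ideal :: "'g::real_lie_algebra free_algebra set"
  where
    "gen (x + y) - gen x - gen y \<in> uea_ideal"
  | "gen (r *\<^sub>R x) - complex_of_real r *\<^sub>C gen x \<in> uea_ideal"
  | "gen x * gen y - gen y * gen x - gen (lie_bracket x y) \<in> uea_ideal"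
  | ideal_add: "a \<in> uea_ideal \<Longrightarrow> b \<in> uea_ideal \<Longrightarrow> a + b \<in> uea_ideal"
  | ideal_left: "a \<in> uea_ideal \<Longrightarrow> c * a \<in> uea_ideal"
  | ideal_right: "a \<in> uea_ideal \<Longrightarrow> a * c \<in> uea_ideal"

lemma ideal_zero: "0 \<in> uea_ideal"
  using ideal_left[OF uea_ideal.intros(1), of 0] by simp

lemma ideal_uminus: "x \<in> uea_ideal \<Longrightarrow> - x \<in> uea_ideal"
  using ideal_left[of x "-1"] by simp

lemma ideal_diff: "x \<in> uea_ideal \<Longrightarrow> y \<in> uea_ideal \<Longrightarrow> x - y \<in> uea_ideal"
  using ideal_add[of x "- y"] ideal_uminus[of y] by simp

lemma ideal_scaleC: "x \<in> uea_ideal \<Longrightarrow> c *\<^sub>C x \<in> uea_ideal"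
  using ideal_left[of x "c *\<^sub>C 1"] by (simp add: mult_scaleC_left)

quotient_type (overloaded) 'g uea =
  "'g::real_lie_algebra free_algebra" / "\<lambda>x y. x - y \<in> uea_ideal"
proof (rule equivpI)
  show "reflp (\<lambda>x y :: 'g free_algebra. x - y \<in> uea_ideal)"
    by (auto simp: reflp_def ideal_zero)
  show "symp (\<lambda>x y :: 'g free_algebra. x - y \<in> uea_ideal)"
    using ideal_uminus by (fastforce simp: symp_def)
  show "transp (\<lambda>x y :: 'g free_algebra. x - y \<in> uea_ideal)"
    using ideal_add by (fastforce simp: transp_def)
qed

lemma free_eval_ideal:
  fixes \<phi> :: "'g::real_lie_algebra \<Rightarrow> 'a::complex_algebra_1"
  assumes "\<And>x y. \<phi> (x + y) = \<phi> x + \<phi> y" "\<And>r x. \<phi> (r *\<^sub>R x) = complex_of_real r *\<^sub>C \<phi> x"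
    and "\<And>x y. \<phi> (lie_bracket x y) = \<phi> x * \<phi> y - \<phi> y * \<phi> x"
    and "a \<in> uea_ideal"
  shows "free_eval \<phi> a = 0"
  using assms(4) by induction (simp_all add: free_eval_simps free_eval_mult assms(1-3))

instantiation uea :: (real_lie_algebra) complex_algebra_1
begin
lift_definition zero_uea :: "'a uea" is 0 .
lift_definition one_uea :: "'a uea" is 1 .
lift_definition plus_uea :: "'a uea \<Rightarrow> 'a uea \<Rightarrow> 'a uea" is "(+)"
  using ideal_add by (metis add_diff_add)
lift_definition uminus_uea :: "'a uea \<Rightarrow> 'a uea" is "uminus"
  using ideal_uminus by (metis minus_diff_minus)
lift_definition minus_uea :: "'a uea \<Rightarrow> 'a uea \<Rightarrow> 'a uea" is "(-)"
  using ideal_diff by (metis (no_types, lifting) add_diff_add diff_conv_add_uminus minus_diff_minus)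
lift_definition scaleC_uea :: "complex \<Rightarrow> 'a uea \<Rightarrow> 'a uea" is "scaleC"
  using ideal_scaleC by (metis cvec.scale_right_diff_distrib)
lift_definition times_uea :: "'a uea \<Rightarrow> 'a uea \<Rightarrow> 'a uea" is "(*)"
proof -
  fix a a' b b' :: "'a free_algebra"
  assume "a - a' \<in> uea_ideal" "b - b' \<in> uea_ideal"
  then have "(a - a') * b + a' * (b - b') \<in> uea_ideal"
    by (intro ideal_add ideal_left ideal_right)
  then show "a * b - a' * b' \<in> uea_ideal"
    by (simp add: algebra_simps)
qed
instance
proof
  show "(0 :: 'a uea) \<noteq> 1"
  proof
    assume "(0 :: 'a uea) = 1"
    then have "(0 - 1 :: 'a free_algebra) \<in> uea_ideal"
      by transfer
    then have "free_eval (\<lambda>_. 0 :: complex) (0 - 1 :: 'a free_algebra) = 0"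
      by (intro free_eval_ideal) simp_all
    then show False
      by (simp add: free_eval_simps)
  qed
qed (transfer; simp add: ideal_zero scaleC_add_right scaleC_add_left mult_scaleC_left
    mult_scaleC_right algebra_simps)+
end

lift_definition uea_of :: "'g::real_lie_algebra \<Rightarrow> 'g uea" is gen .

lemma uea_of_relations:
  "uea_of (x + y) = uea_of x + uea_of y"
  "uea_of (r *\<^sub>R x) = complex_of_real r *\<^sub>C uea_of x"
  "uea_of (lie_bracket x y) = uea_of x * uea_of y - uea_of y * uea_of x"
proof -
  show "uea_of (x + y) = uea_of x + uea_of y"
    by transfer (use uea_ideal.intros(1) in \<open>simp add: diff_diff_eq\<close>)
  show "uea_of (r *\<^sub>R x) = complex_of_real r *\<^sub>C uea_of x"
    by transfer (rule uea_ideal.intros)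
  show "uea_of (lie_bracket x y) = uea_of x * uea_of y - uea_of y * uea_of x"
    by transfer (use ideal_uminus[OF uea_ideal.intros(3)] in simp)
qed

lift_definition comul :: "'g::real_lie_algebra uea \<Rightarrow> ('g uea, 'g uea) tensor"
  is "free_eval (\<lambda>x. uea_of x \<otimes> 1 + 1 \<otimes> uea_of x)"
proof -
  fix a b :: "'g free_algebra"
  assume "a - b \<in> uea_ideal"
  then have "free_eval (\<lambda>x. uea_of x \<otimes> 1 + 1 \<otimes> uea_of x) (a - b) = 0"
    by (intro free_eval_ideal)
      (simp_all add: uea_of_relations pure_simps scaleC_add_right algebra_simps)
  then show "free_eval (\<lambda>x. uea_of x \<otimes> 1 + 1 \<otimes> uea_of x) a =
      free_eval (\<lambda>x. uea_of x \<otimes> 1 + 1 \<otimes> uea_of x) b"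
    by (simp add: free_eval_simps)
qed

lemma comul_uea_of [simp]: "comul (uea_of x) = uea_of x \<otimes> 1 + 1 \<otimes> uea_of x"
  by transfer simp

lemma comul_one [simp]: "comul 1 = 1"
  by transfer simp

lemma comul_mult: "comul (x * y) = comul x * comul y"
  by transfer (rule free_eval_mult)

lemma clinear_comul: "clinear comul"
  by (rule clinearI; transfer) (simp_all add: free_eval_simps)


section \<open>The Heisenberg Lie algebra\<close>

datatype heis = Heis (p_coord: real) (q_coord: real) (t_coord: real)

instantiation heis :: real_lie_algebra
begin
definition zero_heis :: heis
  where "0 = Heis 0 0 0"
definition plus_heis :: "heis \<Rightarrow> heis \<Rightarrow> heis"
  where "x + y = Heis (p_coord x + p_coord y) (q_coord x + q_coord y) (t_coord x + t_coord y)"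
definition uminus_heis :: "heis \<Rightarrow> heis"
  where "- x = Heis (- p_coord x) (- q_coord x) (- t_coord x)"
definition minus_heis :: "heis \<Rightarrow> heis \<Rightarrow> heis"
  where "x - y = Heis (p_coord x - p_coord y) (q_coord x - q_coord y) (t_coord x - t_coord y)"
definition scaleR_heis :: "real \<Rightarrow> heis \<Rightarrow> heis"
  where "r *\<^sub>R x = Heis (r * p_coord x) (r * q_coord x) (r * t_coord x)"
definition lie_bracket_heis :: "heis \<Rightarrow> heis \<Rightarrow> heis"
  where "lie_bracket x y = Heis 0 0 (p_coord x * q_coord y - q_coord x * p_coord y)"
instance
  by standard
    (simp_all add: zero_heis_def plus_heis_def uminus_heis_def minus_heis_def scaleR_heis_def
      lie_bracket_heis_def algebra_simps)
end

definition heis_p :: heis where "heis_p = Heis 1 0 0"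
definition heis_q :: heis where "heis_q = Heis 0 1 0"
definition heis_t :: heis where "heis_t = Heis 0 0 1"

lemma heis_basis: "x = p_coord x *\<^sub>R heis_p + q_coord x *\<^sub>R heis_q + t_coord x *\<^sub>R heis_t"
  by (simp add: heis_p_def heis_q_def heis_t_def plus_heis_def scaleR_heis_def)

lemma heis_brackets:
  "lie_bracket heis_p heis_q = heis_t" "lie_bracket heis_t x = 0" "lie_bracket x heis_t = 0"
  by (simp_all add: heis_p_def heis_q_def heis_t_def lie_bracket_heis_def zero_heis_def)


section \<open>Formal power series in the deformation parameter\<close>

text \<open>For complex vector spaces \<open>A\<close> and \<open>B\<close> the \<open>\<nu>\<close>-adically completed tensor product of
  \<open>A[[\<nu>]]\<close> and \<open>B[[\<nu>]]\<close> over \<open>\<complex>[[\<nu>]]\<close> is \<open>(A \<otimes> B)[[\<nu>]]\<close>, with the pairing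
  \<open>fps_tensor\<close> below; its universal property among the modules \<open>C[[\<nu>]]\<close> is the theorem
  \<open>completed_tensor_universal\<close>.  The topology on \<^typ>\<open>'a fps\<close> is the \<open>\<nu>\<close>-adic one.\<close>

definition fps_scale :: "complex fps \<Rightarrow> 'a::complex_vector fps \<Rightarrow> 'a fps"
    (infixr \<open>*\<^sub>\<nu>\<close> 75)
  where "\<theta> *\<^sub>\<nu> X = Abs_fps (\<lambda>n. \<Sum>i\<le>n. fps_nth \<theta> i *\<^sub>C fps_nth X (n - i))"

definition fps_tensor ::
    "'a::complex_vector fps \<Rightarrow> 'b::complex_vector fps \<Rightarrow> ('a, 'b) tensor fps"
    (infixr \<open>\<otimes>\<^sub>\<nu>\<close> 72)
  where "X \<otimes>\<^sub>\<nu> Y = Abs_fps (\<lambda>n. \<Sum>i\<le>n. fps_nth X i \<otimes> fps_nth Y (n - i))"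

text \<open>The \<open>\<complex>[[\<nu>]]\<close>-linear continuous extension of a linear map.\<close>

definition fps_extend :: "('a::complex_vector \<Rightarrow> 'b::complex_vector) \<Rightarrow> 'a fps \<Rightarrow> 'b fps"
  where "fps_extend f X = Abs_fps (\<lambda>n. f (fps_nth X n))"

definition fps_linear :: "('a::complex_vector fps \<Rightarrow> 'b::complex_vector fps) \<Rightarrow> bool"
  where "fps_linear L \<longleftrightarrow>
    (\<forall>X Y. L (X + Y) = L X + L Y) \<and> (\<forall>\<theta> X. L (\<theta> *\<^sub>\<nu> X) = \<theta> *\<^sub>\<nu> L X)"

lemma fps_scale_nth: "fps_nth (\<theta> *\<^sub>\<nu> X) n = (\<Sum>i\<le>n. fps_nth \<theta> i *\<^sub>C fps_nth X (n - i))"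
  by (simp add: fps_scale_def)

lemma fps_tensor_nth: "fps_nth (X \<otimes>\<^sub>\<nu> Y) n = (\<Sum>i\<le>n. fps_nth X i \<otimes> fps_nth Y (n - i))"
  by (simp add: fps_tensor_def)

lemma fps_extend_nth [simp]: "fps_nth (fps_extend f X) n = f (fps_nth X n)"
  by (simp add: fps_extend_def)

lemma fps_linearD:
  assumes "fps_linear L"
  shows "L (X + Y) = L X + L Y" "L (\<theta> *\<^sub>\<nu> X) = \<theta> *\<^sub>\<nu> L X"
  using assms by (simp_all add: fps_linear_def)

lemma fps_const_scale: "fps_const c *\<^sub>\<nu> X = c *\<^sub>C X"
proof (rule fps_ext)
  fix n
  have "fps_nth (fps_const c *\<^sub>\<nu> X) n =
      (\<Sum>i\<le>n. if i = 0 then c *\<^sub>C fps_nth X n else 0)"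
    unfolding fps_scale_nth by (rule sum.cong) auto
  then show "fps_nth (fps_const c *\<^sub>\<nu> X) n = fps_nth (c *\<^sub>C X) n"
    by simp
qed

lemma fps_X_scale: "fps_nth (fps_X *\<^sub>\<nu> X) n = (if n = 0 then 0 else fps_nth X (n - 1))"
proof -
  have "fps_nth (fps_X *\<^sub>\<nu> X) n =
      (\<Sum>i\<le>n. if i = 1 then fps_nth X (n - 1) else 0)"
    unfolding fps_scale_nth by (rule sum.cong) auto
  then show ?thesis
    by simp
qed

lemma fps_const_scaleC: "fps_const (c *\<^sub>C a) = c *\<^sub>C fps_const a"
  by (rule fps_ext) auto

lemma fps_const_pure: "fps_const (a \<otimes> b) = fps_const a \<otimes>\<^sub>\<nu> fps_const b"
proof (rule fps_ext)
  fix n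
  have "fps_nth (fps_const a \<otimes>\<^sub>\<nu> fps_const b) n =
      (\<Sum>i\<le>n. if i = 0 \<and> n = 0 then a \<otimes> b else 0)"
    unfolding fps_tensor_nth by (rule sum.cong) (auto simp: pure_simps)
  also have "\<dots> = fps_nth (fps_const (a \<otimes> b)) n"
    by (cases "n = 0") auto
  finally show "fps_nth (fps_const (a \<otimes> b)) n = fps_nth (fps_const a \<otimes>\<^sub>\<nu> fps_const b) n"
    by simp
qed

lemma sum_reindex_triangle:
  fixes f :: "nat \<Rightarrow> nat \<Rightarrow> nat \<Rightarrow> 'a::comm_monoid_add"
  shows "(\<Sum>j\<le>n. \<Sum>i\<le>j. f i (j - i) (n - j)) = (\<Sum>j\<le>n. \<Sum>i\<le>n - j. f j i (n - j - i))"
  using fps_mult_assoc_lemma[where f = f and k = n] by (simp add: atMost_atLeast0)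

lemma fps_linear_nth:
  assumes "fps_linear L"
  shows "fps_nth (L X) n = (\<Sum>i\<le>n. fps_nth (L (fps_const (fps_nth X i))) (n - i))"
proof (induction n arbitrary: X)
  have split: "L X = L (fps_const (fps_nth X 0)) + fps_X *\<^sub>\<nu> L (fps_shift 1 X)" for X
  proof -
    have "X = fps_const (fps_nth X 0) + fps_X *\<^sub>\<nu> fps_shift 1 X"
      by (rule fps_ext) (simp add: fps_X_scale)
    then have "L X = L (fps_const (fps_nth X 0) + fps_X *\<^sub>\<nu> fps_shift 1 X)"
      by simp
    then show ?thesis
      by (simp add: fps_linearD[OF assms])
  qed
  {
    case 0
    show ?case
      by (subst split) (simp add: fps_X_scale)
  next
    case (Suc n)
    show ?case
      unfolding sum.atMost_Suc_shift
      by (subst split) (simp add: fps_X_scale Suc)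
  }
qed

theorem completed_tensor_universal:
  fixes \<beta> :: "'a::complex_vector fps \<Rightarrow> 'b::complex_vector fps \<Rightarrow> 'c::complex_vector fps"
  assumes "\<And>X. fps_linear (\<beta> X)" "\<And>Y. fps_linear (\<lambda>X. \<beta> X Y)"
  shows "\<exists>!L. fps_linear L \<and> (\<forall>X Y. L (X \<otimes>\<^sub>\<nu> Y) = \<beta> X Y)"
proof (rule ex_ex1I)
  note \<beta> = fps_linearD[OF assms(1)] fps_linearD[OF assms(2)]
  define l where "l = tensor_lift (\<lambda>a b. \<beta> (fps_const a) (fps_const b))"
  have bil: "cbilinear (\<lambda>a b. \<beta> (fps_const a) (fps_const b))"
    by (rule cbilinearI)
      (simp_all add: \<beta> fps_const_scaleC flip: fps_const_add fps_const_scale)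
  note l = clinearD[OF clinear_tensor_lift[OF bil], folded l_def]
  define L where "L Z = Abs_fps (\<lambda>n. \<Sum>i\<le>n. fps_nth (l (fps_nth Z i)) (n - i))" for Z
  have "fps_linear L"
    unfolding fps_linear_def
  proof (intro conjI allI)
    show "L (X + Y) = L X + L Y" for X Y
      by (simp add: fps_eq_iff L_def l sum.distrib)
    show "L (\<theta> *\<^sub>\<nu> X) = \<theta> *\<^sub>\<nu> L X" for \<theta> X
    proof (rule fps_ext)
      fix n
      have "fps_nth (L (\<theta> *\<^sub>\<nu> X)) n = (\<Sum>i\<le>n. \<Sum>k\<le>i.
          fps_nth \<theta> k *\<^sub>C fps_nth (l (fps_nth X (i - k))) (n - i))"
        by (simp add: L_def fps_scale_nth l fps_sum_nth)
      also have "\<dots> = (\<Sum>k\<le>n. \<Sum>i\<le>n - k.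
          fps_nth \<theta> k *\<^sub>C fps_nth (l (fps_nth X i)) (n - k - i))"
        by (rule sum_reindex_triangle)
      also have "\<dots> = fps_nth (\<theta> *\<^sub>\<nu> L X) n"
        by (simp add: L_def fps_scale_nth cvec.scale_sum_right)
      finally show "fps_nth (L (\<theta> *\<^sub>\<nu> X)) n = fps_nth (\<theta> *\<^sub>\<nu> L X) n" .
    qed
  qed
  moreover have "L (X \<otimes>\<^sub>\<nu> Y) = \<beta> X Y" for X Y
  proof (rule fps_ext)
    fix n
    have "fps_nth (L (X \<otimes>\<^sub>\<nu> Y)) n = (\<Sum>i\<le>n. \<Sum>k\<le>i.
        fps_nth (\<beta> (fps_const (fps_nth X k)) (fps_const (fps_nth Y (i - k)))) (n - i))"
      by (simp add: L_def fps_tensor_nth l fps_sum_nth) (simp add: l_def bil)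
    also have "\<dots> = (\<Sum>k\<le>n. \<Sum>i\<le>n - k.
        fps_nth (\<beta> (fps_const (fps_nth X k)) (fps_const (fps_nth Y i))) (n - k - i))"
      by (rule sum_reindex_triangle)
    also have "\<dots> = (\<Sum>k\<le>n. fps_nth (\<beta> (fps_const (fps_nth X k)) Y) (n - k))"
      by (intro sum.cong refl fps_linear_nth[OF assms(1), symmetric])
    also have "\<dots> = fps_nth (\<beta> X Y) n"
      by (rule fps_linear_nth[OF assms(2), symmetric])
    finally show "fps_nth (L (X \<otimes>\<^sub>\<nu> Y)) n = fps_nth (\<beta> X Y) n" .
  qed
  ultimately show "\<exists>L. fps_linear L \<and> (\<forall>X Y. L (X \<otimes>\<^sub>\<nu> Y) = \<beta> X Y)"
    by blast
next
  fix L L'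
  assume "fps_linear L \<and> (\<forall>X Y. L (X \<otimes>\<^sub>\<nu> Y) = \<beta> X Y)"
    and "fps_linear L' \<and> (\<forall>X Y. L' (X \<otimes>\<^sub>\<nu> Y) = \<beta> X Y)"
  then have L: "fps_linear L" "fps_linear L'" "L (X \<otimes>\<^sub>\<nu> Y) = L' (X \<otimes>\<^sub>\<nu> Y)" for X Y
    by auto
  have const: "L (fps_const t) = L' (fps_const t)" for t
    by (induction t)
      (simp_all add: fps_const_pure L(3) fps_linearD[OF L(1)] fps_linearD[OF L(2)]
        flip: fps_const_add)
  show "L = L'"
  proof (intro ext fps_ext)
    fix X n
    show "fps_nth (L X) n = fps_nth (L' X) n"
      unfolding fps_linear_nth[OF L(1), of X] fps_linear_nth[OF L(2), of X] const ..
  qed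
qed

lemma fps_linear_fps_tensor: "fps_linear (\<lambda>Y. X \<otimes>\<^sub>\<nu> Y)" "fps_linear (\<lambda>X. X \<otimes>\<^sub>\<nu> Y)"
proof -
  show "fps_linear (\<lambda>X. X \<otimes>\<^sub>\<nu> Y)"
    unfolding fps_linear_def
  proof (intro conjI allI fps_ext)
    show "fps_nth ((X + X') \<otimes>\<^sub>\<nu> Y) n = fps_nth (X \<otimes>\<^sub>\<nu> Y + X' \<otimes>\<^sub>\<nu> Y) n" for X X' n
      by (simp add: fps_tensor_nth pure_simps sum.distrib)
    show "fps_nth ((\<theta> *\<^sub>\<nu> X) \<otimes>\<^sub>\<nu> Y) n = fps_nth (\<theta> *\<^sub>\<nu> (X \<otimes>\<^sub>\<nu> Y)) n" for \<theta> X n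
      using sum_reindex_triangle[of
          "\<lambda>i j k. fps_nth \<theta> i *\<^sub>C (fps_nth X j \<otimes> fps_nth Y k)" n]
      by (simp add: fps_tensor_nth fps_scale_nth pure_simps cvec.scale_sum_right)
  qed
  show "fps_linear (\<lambda>Y. X \<otimes>\<^sub>\<nu> Y)"
    unfolding fps_linear_def
  proof (intro conjI allI fps_ext)
    show "fps_nth (X \<otimes>\<^sub>\<nu> (Y + Y')) n = fps_nth (X \<otimes>\<^sub>\<nu> Y + X \<otimes>\<^sub>\<nu> Y') n" for Y Y' n
      by (simp add: fps_tensor_nth pure_simps sum.distrib)
    show "fps_nth (X \<otimes>\<^sub>\<nu> \<theta> *\<^sub>\<nu> Y) n = fps_nth (\<theta> *\<^sub>\<nu> (X \<otimes>\<^sub>\<nu> Y)) n" for \<theta> Y n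
    proof -
      have "fps_nth (X \<otimes>\<^sub>\<nu> \<theta> *\<^sub>\<nu> Y) n = (\<Sum>i\<le>n. \<Sum>j\<le>n - i.
          fps_nth \<theta> j *\<^sub>C (fps_nth X i \<otimes> fps_nth Y (n - i - j)))"
        by (simp add: fps_tensor_nth fps_scale_nth pure_simps)
      also have "\<dots> = (\<Sum>j\<le>n. \<Sum>i\<le>n - j.
          fps_nth \<theta> j *\<^sub>C (fps_nth X i \<otimes> fps_nth Y (n - j - i)))"
        unfolding sum.Sigma[OF finite_atMost ballI[OF finite_atMost]]
        by (rule sum.reindex_bij_witness[of _ prod.swap prod.swap])
          (auto simp: add.commute)
      finally show ?thesis
        by (simp add: fps_tensor_nth fps_scale_nth cvec.scale_sum_right)
    qed
  qed
qed

lemma fps_linear_fps_extend: "clinear f \<Longrightarrow> fps_linear (fps_extend f)"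
  by (simp add: fps_linear_def fps_eq_iff fps_scale_nth clinearD)

lemma fps_extend_tensor_map:
  "clinear f \<Longrightarrow> clinear g \<Longrightarrow>
    fps_extend (tensor_map f g) (X \<otimes>\<^sub>\<nu> Y) = fps_extend f X \<otimes>\<^sub>\<nu> fps_extend g Y"
  by (simp add: fps_eq_iff fps_tensor_nth clinearD[OF clinear_tensor_map])

lemma fps_extend_tensor_assoc:
  "fps_extend tensor_assoc ((X \<otimes>\<^sub>\<nu> Y) \<otimes>\<^sub>\<nu> Z) = X \<otimes>\<^sub>\<nu> Y \<otimes>\<^sub>\<nu> Z"
  using sum_reindex_triangle[of "\<lambda>i j k. fps_nth X i \<otimes> fps_nth Y j \<otimes> fps_nth Z k"]
  by (simp add: fps_eq_iff fps_tensor_nth clinearD[OF clinear_tensor_assoc] pure_simps)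

definition formal_exp :: "'a::complex_algebra_1 fps \<Rightarrow> 'a fps"
  where "formal_exp X = suminf (\<lambda>n. complex_of_real (1 / fact n) *\<^sub>C X ^ n)"

lemma power_nth_eq_0:
  fixes X :: "'a::ring_1 fps"
  assumes "fps_nth X 0 = 0" "n < k"
  shows "fps_nth (X ^ k) n = 0"
  using assms(2)
proof (induction k arbitrary: n)
  case (Suc k)
  have "fps_nth X i * fps_nth (X ^ k) (n - i) = 0" if "i \<le> n" for i
  proof (cases "i = 0")
    case True
    then show ?thesis by (simp add: assms(1))
  next
    case False
    then have "n - i < k" using that Suc.prems by linarith
    then show ?thesis by (simp add: Suc.IH)
  qed
  then show ?case
    unfolding power_Suc fps_mult_nth by (intro sum.neutral) auto
qed simp

lemma formal_exp_sums:
  fixes X :: "'a::complex_algebra_1 fps"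
  assumes "fps_nth X 0 = 0"
  shows "(\<lambda>k. complex_of_real (1 / fact k) *\<^sub>C X ^ k) sums formal_exp X"
proof -
  let ?f = "\<lambda>k. complex_of_real (1 / fact k) *\<^sub>C X ^ k"
  define S where "S = Abs_fps (\<lambda>n. \<Sum>k\<le>n. fps_nth (?f k) n)"
  have "?f sums S"
    unfolding sums_def
  proof (rule tendsto_fpsI)
    fix n
    have "fps_nth (sum ?f {..<m}) n = fps_nth S n" if "m > n" for m
      unfolding S_def fps_sum_nth fps_nth_Abs_fps
      using that assms by (intro sum.mono_neutral_right) (auto simp: power_nth_eq_0)
    then show "\<forall>\<^sub>F m in sequentially. fps_nth (sum ?f {..<m}) n = fps_nth S n"
      by (auto simp: eventually_at_top_dense)
  qed
  then show ?thesis
    unfolding formal_exp_def by (simp add: sums_iff)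
qed

definition two_sided_inverse :: "'a::monoid_mult \<Rightarrow> 'a"
  where "two_sided_inverse x = (THE y. x * y = 1 \<and> y * x = 1)"

lemma two_sided_inverse_eqI:
  assumes "x * y = 1" "y * x = 1"
  shows "two_sided_inverse x = y"
  unfolding two_sided_inverse_def
proof (rule the_equality)
  fix z
  assume "x * z = 1 \<and> z * x = 1"
  then have "z * x = 1" ..
  have "z = z * (x * y)"
    by (simp add: assms)
  also have "\<dots> = y"
    by (simp add: \<open>z * x = 1\<close> flip: mult.assoc)
  finally show "z = y" .
qed (use assms in simp)


section \<open>The twists and the associator\<close>

type_synonym H = "heis uea fps"
type_synonym H2 = "(heis uea, heis uea) tensor fps"
type_synonym H3 = "(heis uea, (heis uea, heis uea) tensor) tensor fps"

definition Theta :: "complex fps set"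
  where "Theta = {\<theta>. fps_nth \<theta> 0 = 0}"

definition elt_p :: H where "elt_p = fps_const (uea_of heis_p)"
definition elt_q :: H where "elt_q = fps_const (uea_of heis_q)"
definition elt_t :: H where "elt_t = fps_const (uea_of heis_t)"

definition twist :: "complex fps \<Rightarrow> H2"
  where "twist \<theta> = formal_exp (\<theta> *\<^sub>\<nu> (elt_p \<otimes>\<^sub>\<nu> elt_q))"

definition assoc_Phi :: "complex fps \<Rightarrow> complex fps \<Rightarrow> H3"
  where "assoc_Phi \<theta> \<theta>' = formal_exp
    (- (elt_p \<otimes>\<^sub>\<nu> ((\<theta> - \<theta>') *\<^sub>\<nu> 1 - (\<theta> * \<theta>') *\<^sub>\<nu> elt_t) \<otimes>\<^sub>\<nu> elt_q))"

end

theory Submission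
  imports Defs
begin

text \<open>In \<open>H \<otimes> H \<otimes> H\<close> write \<open>A = - \<theta> 1 \<otimes> p \<otimes> q\<close> and \<open>B = - \<theta>' p \<otimes> q \<otimes> 1\<close>.  Their commutator
  \<open>C = \<theta> \<theta>' p \<otimes> t \<otimes> q\<close> commutes with both, so \<open>e\<^sup>A B = (B + C) e\<^sup>A\<close> and hence the Weyl relation
  \<open>e\<^sup>A e\<^sup>B = e\<^bsup>B + C\<^esup> e\<^sup>A\<close> holds.  All other exponents that occur are multiples of \<open>p \<otimes> 1 \<otimes> q\<close>,
  which commutes with \<open>A\<close>, \<open>B\<close> and \<open>C\<close>, and both sides of the identity equal
  \<open>e\<^bsup>B + C - \<theta> p \<otimes> 1 \<otimes> q\<^esup> e\<^sup>A\<close>.\<close>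

section \<open>The formal exponential\<close>

text \<open>Stated over an arbitrary algebra, so that the commutator identity below is an algebraic
  fact about finite sums. Power series enter only through coefficient comparison.\<close>

definition exp_trunc :: "nat \<Rightarrow> 'a::complex_algebra_1 \<Rightarrow> 'a"
  where "exp_trunc N x = (\<Sum>k\<le>N. complex_of_real (1 / fact k) *\<^sub>C x ^ k)"

text \<open>\<open>X ^ k\<close> has no coefficients below \<open>k\<close>, so coefficient
  \<open>n\<close> of the partial sums is constant once they pass \<open>N\<close>. The free choice
  of \<open>N\<close> lets a single truncation serve all coefficients up to \<open>n\<close> of a
  product.\<close>

lemma formal_exp_nth:
  fixes X :: "'a::complex_algebra_1 fps"
  assumes "fps_nth X 0 = 0" "n \<le> N"
  shows "fps_nth (formal_exp X) n = fps_nth (exp_trunc N X) n"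
proof -
  let ?f = "\<lambda>k. complex_of_real (1 / fact k) *\<^sub>C X ^ k"
  have lim: "(\<lambda>m. sum ?f {..<m}) \<longlonglongrightarrow> formal_exp X"
    using formal_exp_sums[OF assms(1)] by (simp add: sums_def)
  have "\<forall>\<^sub>F m in sequentially. fps_nth (sum ?f {..<m}) n = fps_nth (formal_exp X) n"
    using lim by (simp add: tendsto_fps_iff)
  moreover have "\<forall>\<^sub>F m in sequentially. fps_nth (sum ?f {..<m}) n = fps_nth (exp_trunc N X) n"
  proof (rule eventually_mono[OF eventually_gt_at_top[of N]])
    fix m assume "N < m"
    then show "fps_nth (sum ?f {..<m}) n = fps_nth (exp_trunc N X) n"
      unfolding exp_trunc_def fps_sum_nth using assms
      by (intro sum.mono_neutral_right) (auto simp: power_nth_eq_0)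
  qed
  ultimately have "\<forall>\<^sub>F m in sequentially.
      fps_nth (formal_exp X) n = fps_nth (exp_trunc N X) n"
    by eventually_elim simp
  then show ?thesis
    by simp
qed

lemma fps_mult_nth_cong:
  assumes "\<And>i. i \<le> n \<Longrightarrow> fps_nth X i = fps_nth X' i" "\<And>i. i \<le> n \<Longrightarrow> fps_nth Y i = fps_nth Y' i"
  shows "fps_nth (X * Y) n = fps_nth (X' * Y') n"
  unfolding fps_mult_nth using assms by (intro sum.cong) auto

lemma exp_trunc_0 [simp]: "exp_trunc N 0 = 1"
  unfolding exp_trunc_def by (subst sum.remove[of _ 0]) (auto simp: power_0_left)

lemma formal_exp_0 [simp]: "formal_exp 0 = 1"
  by (rule fps_ext) (simp add: formal_exp_nth[where X = 0, OF _ order_refl])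

section \<open>Exponentials of sums of commuting elements\<close>

lemma commuting_power:
  fixes x y :: "'a::monoid_mult"
  assumes "x * y = y * x"
  shows "x ^ k * y = y * x ^ k"
  using assms power_commuting_commutes by metis

text \<open>The binomial theorem in divided powers: the rule \<open>S_Suc\<close> absorbs the
  factorials, so the induction needs no binomial coefficients.\<close>

lemma exp_series_add:
  fixes x y :: "'a::complex_algebra_1"
  assumes "x * y = y * x"
  shows "complex_of_real (1 / fact n) *\<^sub>C (x + y) ^ n =
    (\<Sum>i\<le>n. (complex_of_real (1 / fact i) *\<^sub>C x ^ i)
      * (complex_of_real (1 / fact (n - i)) *\<^sub>C y ^ (n - i)))"
proof (induction n)
  case (Suc n)
  define S where "S z k = complex_of_real (1 / fact k) *\<^sub>C z ^ k" for z :: 'a and k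
  have S_Suc: "z * S z k = of_nat (Suc k) *\<^sub>C S z (Suc k)" for z k
    by (simp add: S_def mult_scaleC_right del: of_nat_Suc)
  have S_comm: "S x k * y = y * S x k" for k
    using commuting_power[OF assms] by (simp add: S_def mult_scaleC_left mult_scaleC_right)
  have S_left_comm: "S x k * (y * z) = y * (S x k * z)" for k z
    by (simp add: S_comm flip: mult.assoc)
  have IH: "S (x + y) n = (\<Sum>i\<le>n. S x i * S y (n - i))"
    using Suc by (simp add: S_def)
  have "of_nat (Suc n) *\<^sub>C S (x + y) (Suc n) = (x + y) * (\<Sum>i\<le>n. S x i * S y (n - i))"
    by (simp only: IH flip: S_Suc)
  also have "\<dots> = (\<Sum>i\<le>n. x * S x i * S y (n - i)) + (\<Sum>i\<le>n. S x i * (y * S y (n - i)))"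
    by (simp only: distrib_right sum_distrib_left sum.distrib mult.assoc S_left_comm)
  also have "\<dots> = (\<Sum>i\<le>n. of_nat (Suc i) *\<^sub>C (S x (Suc i) * S y (n - i)))
      + (\<Sum>i\<le>n. of_nat (Suc n - i) *\<^sub>C (S x i * S y (Suc n - i)))"
    by (simp only: S_Suc mult_scaleC_left mult_scaleC_right)
      (intro arg_cong2[of _ _ _ _ "(+)"] sum.cong refl, simp add: Suc_diff_le)
  \<comment> \<open>Both sums gain a term with coefficient zero, the first at \<open>i = 0\<close>
    and the second at \<open>i = Suc n\<close>. Their coefficients then add up to
    \<open>Suc n\<close>, which cancels at the end.\<close>
  also have "\<dots> = (\<Sum>i\<le>Suc n. of_nat i *\<^sub>C (S x i * S y (Suc n - i)))
      + (\<Sum>i\<le>Suc n. of_nat (Suc n - i) *\<^sub>C (S x i * S y (Suc n - i)))"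
    by (subst (1) sum.atMost_Suc_shift) (simp del: of_nat_Suc)
  also have "\<dots> = of_nat (Suc n) *\<^sub>C (\<Sum>i\<le>Suc n. S x i * S y (Suc n - i))"
    unfolding cvec.scale_sum_right sum.distrib[symmetric] scaleC_add_left[symmetric]
    by (intro sum.cong refl) (simp flip: of_nat_add)
  finally have "S (x + y) (Suc n) = (\<Sum>i\<le>Suc n. S x i * S y (Suc n - i))"
    by (subst (asm) cvec.scale_cancel_left) (simp del: of_nat_Suc)
  then show ?case
    by (simp only: S_def)
qed simp

text \<open>Terms with \<open>i + j > n\<close> do not reach coefficient \<open>n\<close>, so the
  square of index pairs may be cut down to a triangle. By \<open>exp_series_add\<close> its
  diagonals are the terms of the exponential of the sum.\<close>

lemma formal_exp_add:
  fixes X Y :: "'a::complex_algebra_1 fps"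
  assumes "fps_nth X 0 = 0" "fps_nth Y 0 = 0" "X * Y = Y * X"
  shows "formal_exp (X + Y) = formal_exp X * formal_exp Y"
proof (rule fps_ext)
  fix n
  define S where "S Z k = complex_of_real (1 / fact k) *\<^sub>C Z ^ k" for Z :: "'a fps" and k
  have S_add: "S (X + Y) k = (\<Sum>i\<le>k. S X i * S Y (k - i))" for k
    unfolding S_def by (rule exp_series_add[OF assms(3)])
  have high: "fps_nth (S X i * S Y j) n = 0" if "\<not> i + j \<le> n" for i j
    unfolding fps_mult_nth
  proof (rule sum.neutral, rule)
    fix k assume "k \<in> {0..n}"
    then have "k < i \<or> n - k < j"
      using that by auto
    then show "fps_nth (S X i) k * fps_nth (S Y j) (n - k) = 0"
      using assms by (auto simp: S_def power_nth_eq_0)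
  qed
  have "fps_nth (formal_exp X * formal_exp Y) n = fps_nth (exp_trunc n X * exp_trunc n Y) n"
    using assms by (intro fps_mult_nth_cong) (simp_all add: formal_exp_nth[of _ _ n])
  also have "\<dots> = (\<Sum>i\<le>n. \<Sum>j\<le>n. fps_nth (S X i * S Y j) n)"
    unfolding exp_trunc_def S_def[symmetric] sum_product fps_sum_nth ..
  also have "\<dots> = (\<Sum>(i, j)\<in>{..n} \<times> {..n}. fps_nth (S X i * S Y j) n)"
    by (simp add: sum.cartesian_product)
  also have "\<dots> = (\<Sum>(i, j)\<in>{(i, j). i + j \<le> n}. fps_nth (S X i * S Y j) n)"
    using high by (intro sum.mono_neutral_right) auto
  also have "\<dots> = (\<Sum>k\<le>n. \<Sum>i\<le>k. fps_nth (S X i * S Y (k - i)) n)"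
    by (rule sum.triangle_reindex_eq)
  also have "\<dots> = fps_nth (exp_trunc n (X + Y)) n"
    by (simp only: exp_trunc_def fps_sum_nth S_add flip: S_def)
  also have "\<dots> = fps_nth (formal_exp (X + Y)) n"
    using assms by (simp add: formal_exp_nth[of _ n n])
  finally show "fps_nth (formal_exp (X + Y)) n = fps_nth (formal_exp X * formal_exp Y) n"
    by simp
qed

lemma two_sided_inverse_formal_exp:
  fixes X :: "'a::complex_algebra_1 fps"
  assumes "fps_nth X 0 = 0"
  shows "two_sided_inverse (formal_exp X) = formal_exp (- X)"
  by (rule two_sided_inverse_eqI) (use assms in \<open>simp_all flip: formal_exp_add\<close>)

section \<open>Conjugation by an exponential and the Weyl relation\<close>

lemma intertwine_formal_exp:
  fixes E X Y :: "'a::complex_algebra_1 fps"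
  assumes "fps_nth X 0 = 0" "fps_nth Y 0 = 0" "E * X = Y * E"
  shows "E * formal_exp X = formal_exp Y * E"
proof (rule fps_ext)
  fix n
  have pow: "E * X ^ k = Y ^ k * E" for k
  proof (induction k)
    case (Suc k)
    have "E * X ^ Suc k = Y * (E * X ^ k)"
      by (simp add: assms(3) flip: mult.assoc)
    also have "\<dots> = Y ^ Suc k * E"
      by (simp add: Suc mult.assoc)
    finally show ?case .
  qed simp
  have "fps_nth (E * formal_exp X) n = fps_nth (E * exp_trunc n X) n"
    using assms by (intro fps_mult_nth_cong) (simp_all add: formal_exp_nth[of _ _ n])
  also have "E * exp_trunc n X = exp_trunc n Y * E"
    by (simp add: exp_trunc_def sum_distrib_left sum_distrib_right mult_scaleC_left
        mult_scaleC_right pow)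
  also have "fps_nth \<dots> n = fps_nth (formal_exp Y * E) n"
    using assms by (intro fps_mult_nth_cong) (simp_all add: formal_exp_nth[of _ _ n])
  finally show "fps_nth (E * formal_exp X) n = fps_nth (formal_exp Y * E) n" .
qed

text \<open>Commutation with \<open>b\<close> differentiates powers of \<open>a\<close>, because
  \<open>c\<close> commutes with \<open>a\<close>. Dividing by the factorial turns
  \<open>Suc k\<close> into a shift of the index, which lowers the truncation order in the
  \<open>c\<close> term by one.\<close>

lemma exp_trunc_Suc_commutator:
  fixes a b c :: "'a::complex_algebra_1"
  assumes "a * b = b * a + c" "a * c = c * a"
  shows "exp_trunc (Suc n) a * b = b * exp_trunc (Suc n) a + c * exp_trunc n a"
proof -
  have pow: "a ^ Suc k * b = b * a ^ Suc k + of_nat (Suc k) *\<^sub>C (c * a ^ k)" for k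
  proof (induction k)
    case (Suc k)
    have of_nat_scaleC: "of_nat (Suc (Suc k)) *\<^sub>C y = y + of_nat (Suc k) *\<^sub>C y" for y :: 'a
      by (subst of_nat_Suc) (simp only: scaleC_add_left scaleC_one)
    have "a ^ Suc (Suc k) * b = a * (a ^ Suc k * b)"
      by (simp add: mult.assoc)
    also have "\<dots> = (a * b) * a ^ Suc k + of_nat (Suc k) *\<^sub>C ((a * c) * a ^ k)"
      by (simp only: Suc distrib_left mult_scaleC_right mult.assoc)
    also have "\<dots> = b * a ^ Suc (Suc k) + of_nat (Suc (Suc k)) *\<^sub>C (c * a ^ Suc k)"
      by (simp add: assms distrib_right mult.assoc of_nat_scaleC add_ac del: of_nat_Suc)
    finally show ?case .
  qed (use assms in simp)
  have "(complex_of_real (1 / fact (Suc k)) *\<^sub>C a ^ Suc k) * b =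
      b * (complex_of_real (1 / fact (Suc k)) *\<^sub>C a ^ Suc k)
      + c * (complex_of_real (1 / fact k) *\<^sub>C a ^ k)" for k
    unfolding mult_scaleC_left mult_scaleC_right pow scaleC_add_right
    by (simp add: field_simps del: of_nat_Suc power_Suc)
  then show ?thesis
    unfolding exp_trunc_def sum.atMost_Suc_shift
    by (simp add: distrib_left distrib_right sum_distrib_left sum_distrib_right sum.distrib add_ac
        del: power_Suc fact_Suc)
qed

lemma formal_exp_commutator:
  fixes A B C :: "'a::complex_algebra_1 fps"
  assumes "fps_nth A 0 = 0" "A * B = B * A + C" "A * C = C * A"
  shows "formal_exp A * B = (B + C) * formal_exp A"
proof (rule fps_ext)
  fix n
  \<comment> \<open>Truncation at \<open>Suc n\<close> leaves order \<open>n\<close> for the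
    \<open>C\<close> term, which still determines coefficient \<open>n\<close>.\<close>
  have "fps_nth (formal_exp A * B) n = fps_nth (exp_trunc (Suc n) A * B) n"
    using assms by (intro fps_mult_nth_cong) (simp_all add: formal_exp_nth[of _ _ "Suc n"])
  also have "\<dots> = fps_nth (B * exp_trunc (Suc n) A) n + fps_nth (C * exp_trunc n A) n"
    by (simp add: exp_trunc_Suc_commutator[OF assms(2,3)])
  also have "fps_nth (B * exp_trunc (Suc n) A) n = fps_nth (B * formal_exp A) n"
    using assms by (intro fps_mult_nth_cong) (simp_all add: formal_exp_nth[of _ _ "Suc n"])
  also have "fps_nth (C * exp_trunc n A) n = fps_nth (C * formal_exp A) n"
    using assms by (intro fps_mult_nth_cong) (simp_all add: formal_exp_nth[of _ _ n])
  finally show "fps_nth (formal_exp A * B) n = fps_nth ((B + C) * formal_exp A) n"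
    by (simp add: distrib_right)
qed

text \<open>Moving \<open>formal_exp A\<close> past \<open>B\<close> replaces \<open>B\<close> by
  \<open>B + C\<close>, so moving it past the exponential of \<open>B\<close> does the same in the
  exponent.\<close>

lemma formal_exp_weyl:
  fixes A B C :: "'a::complex_algebra_1 fps"
  assumes "fps_nth A 0 = 0" "fps_nth B 0 = 0" "fps_nth C 0 = 0"
    and "A * B = B * A + C" "A * C = C * A"
  shows "formal_exp A * formal_exp B = formal_exp (B + C) * formal_exp A"
  by (rule intertwine_formal_exp) (use assms formal_exp_commutator[of A B C] in simp_all)

text \<open>The theorem reduced to commutation relations: of the five exponents only
  \<open>A\<close> and \<open>B\<close> may fail to commute. In the application \<open>U\<close> and
  \<open>V\<close> are the multiples of p \<otimes> 1 \<otimes> q that the coproduct creates on the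
  left and on the right side.\<close>

lemma formal_exp_rearrange:
  fixes A B C U V :: "'a::complex_algebra_1 fps"
  assumes zero: "fps_nth A 0 = 0" "fps_nth B 0 = 0" "fps_nth C 0 = 0" "fps_nth U 0 = 0"
      "fps_nth V 0 = 0"
    and comm: "A * B = B * A + C" "A * C = C * A" "B * C = C * B" "A * U = U * A" "B * U = U * B"
      "C * U = U * C" "A * V = V * A" "B * V = V * B" "C * V = V * C" "U * V = V * U"
  shows "formal_exp (U + A) * formal_exp B
    = formal_exp (B + V) * formal_exp A * formal_exp (U - V + C)"
proof -
  have W: "fps_nth (U - V + C) 0 = 0" "(U - V + C) * A = A * (U - V + C)"
    using zero comm by (simp_all add: algebra_simps)
  have swap: "formal_exp (U - V + C) * formal_exp A = formal_exp A * formal_exp (U - V + C)"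
    using formal_exp_add[OF W(1) zero(1) W(2)] formal_exp_add[OF zero(1) W(1) W(2)[symmetric]]
    by (simp only: add.commute)
  have "formal_exp (U + A) * formal_exp B = formal_exp U * (formal_exp A * formal_exp B)"
    using zero comm by (simp add: formal_exp_add mult.assoc)
  also have "\<dots> = formal_exp (U + (B + C)) * formal_exp A"
    using zero comm
    by (subst formal_exp_add) (simp_all add: formal_exp_weyl mult.assoc distrib_left distrib_right)
  \<comment> \<open>Inserting and cancelling \<open>V\<close> separates the first factor of the
    claim from the exponent of the associator.\<close>
  also have "U + (B + C) = (B + V) + (U - V + C)"
    by simp
  also have "formal_exp \<dots> = formal_exp (B + V) * formal_exp (U - V + C)"
    using zero comm by (intro formal_exp_add) (simp_all add: algebra_simps)
  also have "\<dots> * formal_exp A = formal_exp (B + V) * (formal_exp A * formal_exp (U - V + C))"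
    by (simp only: mult.assoc swap)
  finally show ?thesis
    by (simp add: mult.assoc)
qed


section \<open>Algebra homomorphisms\<close>

definition calgebra_hom :: "('a::complex_algebra_1 \<Rightarrow> 'b::complex_algebra_1) \<Rightarrow> bool"
  where "calgebra_hom f \<longleftrightarrow> clinear f \<and> f 1 = 1 \<and> (\<forall>x y. f (x * y) = f x * f y)"

lemma calgebra_homI:
  assumes "clinear f" "f 1 = 1" "\<And>x y. f (x * y) = f x * f y"
  shows "calgebra_hom f"
  using assms by (simp add: calgebra_hom_def)

lemma calgebra_homD:
  assumes "calgebra_hom f"
  shows "clinear f" "f 1 = 1" "f (x * y) = f x * f y"
  using assms by (simp_all add: calgebra_hom_def)

lemma calgebra_hom_id: "calgebra_hom id"
  by (intro calgebra_homI clinearI) simp_all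

lemma calgebra_hom_comul: "calgebra_hom comul"
  by (intro calgebra_homI clinear_comul comul_mult comul_one)

lemma calgebra_hom_pure_left: "calgebra_hom (\<lambda>x. x \<otimes> 1)"
  by (intro calgebra_homI clinear_pure) (simp_all add: one_tensor_def)

lemma calgebra_hom_pure_right: "calgebra_hom (\<lambda>x. 1 \<otimes> x)"
  by (intro calgebra_homI clinear_pure) (simp_all add: one_tensor_def)

text \<open>Pure tensors span and multiplication is bilinear, so multiplicativity can be tested on
  them.\<close>

lemma calgebra_hom_tensorI:
  assumes lin: "clinear f" and one: "f 1 = 1"
    and mult: "\<And>a b c d. f ((a \<otimes> b) * (c \<otimes> d)) = f (a \<otimes> b) * f (c \<otimes> d)"
  shows "calgebra_hom f"
proof (rule calgebra_homI[OF lin one])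
  fix x y
  show "f (x * y) = f x * f y"
  proof (induction x)
    case (pure a b)
    show ?case
      by (induction y) (simp_all add: mult clinearD(1)[OF lin] distrib_left del: pure_times_pure)
  qed (simp add: clinearD(1)[OF lin] distrib_right)
qed

lemma calgebra_hom_tensor_map:
  assumes "calgebra_hom f" "calgebra_hom g"
  shows "calgebra_hom (tensor_map f g)"
  using assms
  by (intro calgebra_hom_tensorI clinear_tensor_map) (simp_all add: calgebra_homD one_tensor_def)

text \<open>The left factor of a pure tensor is itself a tensor here, so a further induction
  descends to triple pure tensors.\<close>

lemma calgebra_hom_tensor_assoc: "calgebra_hom tensor_assoc"
proof (rule calgebra_hom_tensorI[OF clinear_tensor_assoc])
  note lin = clinearD(1)[OF clinear_tensor_assoc]
  show "tensor_assoc (1 :: (('a, 'b) tensor, 'c) tensor) = 1"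
    by (simp add: one_tensor_def)
  fix x y :: "('a, 'b) tensor" and c d :: 'c
  show "tensor_assoc ((x \<otimes> c) * (y \<otimes> d)) = tensor_assoc (x \<otimes> c) * tensor_assoc (y \<otimes> d)"
  proof (induction x)
    case (pure a b)
    show ?case
      by (induction y) (simp_all add: lin pure_simps distrib_left)
  qed (simp add: lin pure_simps distrib_right)
qed

lemma fps_extend_mult:
  assumes "calgebra_hom f"
  shows "fps_extend f (X * Y) = fps_extend f X * fps_extend f Y"
  using assms by (simp add: fps_eq_iff fps_mult_nth calgebra_homD clinearD)

lemma fps_extend_power:
  assumes "calgebra_hom f"
  shows "fps_extend f (X ^ k) = fps_extend f X ^ k"
proof (induction k)
  case 0
  show ?case
    using assms by (simp add: fps_eq_iff calgebra_homD clinearD)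
qed (simp add: fps_extend_mult[OF assms])

text \<open>Each coefficient of the exponential comes from a finite sum of powers, which the
  homomorphism respects. This moves coproducts, unit factors and reassociation into the
  exponents.\<close>

lemma fps_extend_formal_exp:
  assumes f: "calgebra_hom f" and X: "fps_nth X 0 = 0"
  shows "fps_extend f (formal_exp X) = formal_exp (fps_extend f X)"
proof (rule fps_ext)
  fix n
  note lin = clinearD[OF calgebra_homD(1)[OF f]]
  show "fps_nth (fps_extend f (formal_exp X)) n = fps_nth (formal_exp (fps_extend f X)) n"
    using X by (simp add: formal_exp_nth[of _ n n] lin exp_trunc_def fps_sum_nth
        flip: fps_extend_power[OF f])
qed


section \<open>Scalar multiples of constant series\<close>

lemma fps_scale_const_nth [simp]: "fps_nth (\<theta> *\<^sub>\<nu> fps_const a) n = fps_nth \<theta> n *\<^sub>C a"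
proof -
  have "fps_nth (\<theta> *\<^sub>\<nu> fps_const a) n = (\<Sum>i\<le>n. if i = n then fps_nth \<theta> n *\<^sub>C a else 0)"
    unfolding fps_scale_nth by (rule sum.cong) auto
  then show ?thesis
    by simp
qed

lemma fps_scale_const_add:
  "\<theta> *\<^sub>\<nu> fps_const (a + b) = \<theta> *\<^sub>\<nu> fps_const a + \<theta> *\<^sub>\<nu> fps_const b"
  by (simp add: fps_eq_iff scaleC_add_right del: fps_const_add)

text \<open>Reduces commutators of the exponents to commutators of constant tensors.\<close>

lemma fps_scale_const_mult:
  fixes a b :: "'a::complex_algebra_1"
  shows "(\<theta> *\<^sub>\<nu> fps_const a) * (\<theta>' *\<^sub>\<nu> fps_const b) = (\<theta> * \<theta>') *\<^sub>\<nu> fps_const (a * b)"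
  by (simp add: fps_eq_iff fps_mult_nth mult_scaleC_left mult_scaleC_right cvec.scale_sum_left
      mult.commute)

lemma fps_extend_scale_const:
  assumes "clinear f"
  shows "fps_extend f (\<theta> *\<^sub>\<nu> fps_const a) = \<theta> *\<^sub>\<nu> fps_const (f a)"
  using assms by (simp add: fps_eq_iff clinearD)

text \<open>Presents the unit factor as the extension of an algebra homomorphism, so that
  \<open>fps_extend_formal_exp\<close> applies.\<close>

lemma fps_tensor_one_right: "X \<otimes>\<^sub>\<nu> 1 = fps_extend (\<lambda>x. x \<otimes> 1) X"
proof (rule fps_ext)
  fix n
  have "fps_nth (X \<otimes>\<^sub>\<nu> 1) n = (\<Sum>i\<le>n. if i = n then fps_nth X n \<otimes> 1 else 0)"
    unfolding fps_tensor_nth by (rule sum.cong) (auto simp: pure_simps)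
  then show "fps_nth (X \<otimes>\<^sub>\<nu> 1) n = fps_nth (fps_extend (\<lambda>x. x \<otimes> 1) X) n"
    by simp
qed

lemma fps_tensor_one_left: "1 \<otimes>\<^sub>\<nu> X = fps_extend (\<lambda>x. 1 \<otimes> x) X"
proof (rule fps_ext)
  fix n
  have "fps_nth (1 \<otimes>\<^sub>\<nu> X) n = (\<Sum>i\<le>n. if i = 0 then 1 \<otimes> fps_nth X n else 0)"
    unfolding fps_tensor_nth by (rule sum.cong) (auto simp: pure_simps)
  then show "fps_nth (1 \<otimes>\<^sub>\<nu> X) n = fps_nth (fps_extend (\<lambda>x. 1 \<otimes> x) X) n"
    by simp
qed


section \<open>The twists in the triple tensor product\<close>

lemma uea_heis_commute:
  "uea_of heis_p * uea_of heis_q = uea_of heis_q * uea_of heis_p + uea_of heis_t"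
  "uea_of heis_t * uea_of x = uea_of x * uea_of heis_t"
proof -
  have zero: "uea_of (0 :: heis) = 0"
    using uea_of_relations(1)[of "0 :: heis" 0] by simp
  show "uea_of heis_p * uea_of heis_q = uea_of heis_q * uea_of heis_p + uea_of heis_t"
    using uea_of_relations(3)[of heis_p heis_q] by (simp add: heis_brackets)
  show "uea_of heis_t * uea_of x = uea_of x * uea_of heis_t"
    using uea_of_relations(3)[of heis_t x] by (simp add: heis_brackets zero)
qed

lemma twist_inverse:
  assumes "\<theta> \<in> Theta"
  shows "two_sided_inverse (twist \<theta>)
    = formal_exp ((- \<theta>) *\<^sub>\<nu> fps_const (uea_of heis_p \<otimes> uea_of heis_q))"
proof -
  have "- (\<theta> *\<^sub>\<nu> fps_const a) = (- \<theta>) *\<^sub>\<nu> fps_const a" for a :: "(heis uea, heis uea) tensor"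
    by (simp add: fps_eq_iff)
  then show ?thesis
    using assms
    by (simp add: twist_def elt_p_def elt_q_def two_sided_inverse_formal_exp Theta_def
        flip: fps_const_pure)
qed

text \<open>Expands the exponent by multilinearity into the form \<open>U - V + C\<close> of
  \<open>formal_exp_rearrange\<close>.\<close>

lemma assoc_Phi_eq:
  "assoc_Phi \<theta> \<theta>' = formal_exp
    ((- \<theta>) *\<^sub>\<nu> fps_const (uea_of heis_p \<otimes> 1 \<otimes> uea_of heis_q)
      - (- \<theta>') *\<^sub>\<nu> fps_const (uea_of heis_p \<otimes> 1 \<otimes> uea_of heis_q)
      + (\<theta> * \<theta>') *\<^sub>\<nu> fps_const (uea_of heis_p \<otimes> uea_of heis_t \<otimes> uea_of heis_q))"
proof -
  \<comment> \<open>The difference becomes a sum with a negated scalar, since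
    \<open>fps_linearD\<close> provides additivity and homogeneity.\<close>
  have "(\<theta> - \<theta>') *\<^sub>\<nu> 1 - (\<theta> * \<theta>') *\<^sub>\<nu> elt_t = (\<theta> - \<theta>') *\<^sub>\<nu> fps_const 1 + (- (\<theta> * \<theta>')) *\<^sub>\<nu> elt_t"
    by (simp only: elt_t_def fps_const_1_eq_1[symmetric]) (simp add: fps_eq_iff)
  then have "elt_p \<otimes>\<^sub>\<nu> ((\<theta> - \<theta>') *\<^sub>\<nu> 1 - (\<theta> * \<theta>') *\<^sub>\<nu> elt_t) \<otimes>\<^sub>\<nu> elt_q
    = (\<theta> - \<theta>') *\<^sub>\<nu> fps_const (uea_of heis_p \<otimes> 1 \<otimes> uea_of heis_q)
      + (- (\<theta> * \<theta>')) *\<^sub>\<nu> fps_const (uea_of heis_p \<otimes> uea_of heis_t \<otimes> uea_of heis_q)"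
    by (simp only: fps_linearD[OF fps_linear_fps_tensor(1)] fps_linearD[OF fps_linear_fps_tensor(2)]
        elt_p_def elt_q_def elt_t_def fps_const_pure)
  then show ?thesis
    unfolding assoc_Phi_def
    by (intro arg_cong[of _ _ formal_exp]) (simp add: fps_eq_iff cvec.scale_left_diff_distrib)
qed

theorem lemma3p1:
  fixes \<theta> \<theta>' :: "complex fps"
  assumes "\<theta> \<in> Theta" and "\<theta>' \<in> Theta"
  shows "fps_extend tensor_assoc
      (fps_extend (tensor_map comul id) (two_sided_inverse (twist \<theta>))
        * (two_sided_inverse (twist \<theta>') \<otimes>\<^sub>\<nu> 1))
    = fps_extend (tensor_map id comul) (two_sided_inverse (twist \<theta>'))
        * (1 \<otimes>\<^sub>\<nu> two_sided_inverse (twist \<theta>)) * assoc_Phi \<theta> \<theta>'"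
proof -
  let ?p = "uea_of heis_p" and ?q = "uea_of heis_q" and ?t = "uea_of heis_t"
  define A :: H3 where "A = (- \<theta>) *\<^sub>\<nu> fps_const (1 \<otimes> ?p \<otimes> ?q)"
  define B :: H3 where "B = (- \<theta>') *\<^sub>\<nu> fps_const (?p \<otimes> ?q \<otimes> 1)"
  define C :: H3 where "C = (\<theta> * \<theta>') *\<^sub>\<nu> fps_const (?p \<otimes> ?t \<otimes> ?q)"
  define U :: H3 where "U = (- \<theta>) *\<^sub>\<nu> fps_const (?p \<otimes> 1 \<otimes> ?q)"
  define V :: H3 where "V = (- \<theta>') *\<^sub>\<nu> fps_const (?p \<otimes> 1 \<otimes> ?q)"
  note defs = A_def B_def C_def U_def V_def
  have \<theta>0: "fps_nth \<theta> 0 = 0" "fps_nth \<theta>' 0 = 0"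
    using assms by (simp_all add: Theta_def)
  note homs = calgebra_hom_comul calgebra_hom_id calgebra_hom_tensor_map calgebra_hom_tensor_assoc
    calgebra_hom_pure_left calgebra_hom_pure_right
  note lin = calgebra_homD(1)[OF calgebra_hom_comul] calgebra_homD(1)[OF calgebra_hom_id]
  have ext: "fps_extend f (formal_exp (\<tau> *\<^sub>\<nu> fps_const a)) = formal_exp (\<tau> *\<^sub>\<nu> fps_const (f a))"
    if "calgebra_hom f" "fps_nth \<tau> 0 = 0" for f :: "'x::complex_algebra_1 \<Rightarrow> 'y::complex_algebra_1"
      and \<tau> a
    using that by (simp add: fps_extend_formal_exp fps_extend_scale_const calgebra_homD)
  \<comment> \<open>The coproduct of p in the first factor gives one summand for \<open>U\<close>
    and one for \<open>A\<close>. Only the left side is nested to the left, hence the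
    reassociation.\<close>
  have UA: "fps_extend tensor_assoc (fps_extend (tensor_map comul id) (two_sided_inverse (twist \<theta>)))
      = formal_exp (U + A)"
    using assms \<theta>0
    by (simp add: twist_inverse ext homs lin pure_simps one_tensor_def
        clinearD[OF clinear_tensor_assoc])
      (simp add: fps_scale_const_add U_def A_def)
  have B: "fps_extend tensor_assoc (two_sided_inverse (twist \<theta>') \<otimes>\<^sub>\<nu> 1) = formal_exp B"
    using assms \<theta>0 by (simp add: twist_inverse fps_tensor_one_right ext homs B_def)
  have BV: "fps_extend (tensor_map id comul) (two_sided_inverse (twist \<theta>')) = formal_exp (B + V)"
    \<comment> \<open>The coproduct of q in the second factor splits into the summands for
      \<open>B\<close> and \<open>V\<close>.\<close>
    using assms \<theta>0
    by (simp add: twist_inverse ext homs lin pure_simps fps_scale_const_add B_def V_def)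
  have A: "1 \<otimes>\<^sub>\<nu> two_sided_inverse (twist \<theta>) = formal_exp A"
    using assms \<theta>0 by (simp add: twist_inverse fps_tensor_one_left ext homs A_def)
  have Phi: "assoc_Phi \<theta> \<theta>' = formal_exp (U - V + C)"
    by (simp add: assoc_Phi_eq U_def V_def C_def)
  \<comment> \<open>Only the middle factors fail to commute, and there [p, q] = t.\<close>
  have "A * B = B * A + C"
    by (simp add: defs fps_scale_const_mult uea_heis_commute pure_simps)
      (simp add: fps_eq_iff scaleC_add_right mult.commute)
  \<comment> \<open>In each of these pairs one middle factor is 1 or the central t. The first
    factors involve only p and 1, the last only q and 1.\<close>
  moreover have "A * C = C * A" "B * C = C * B" "A * U = U * A" "B * U = U * B" "C * U = U * C"
      "A * V = V * A" "B * V = V * B" "C * V = V * C" "U * V = V * U"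
    by (simp_all add: defs fps_scale_const_mult uea_heis_commute mult.commute)
  ultimately have "formal_exp (U + A) * formal_exp B
      = formal_exp (B + V) * formal_exp A * formal_exp (U - V + C)"
    by (intro formal_exp_rearrange) (simp_all add: defs \<theta>0)
  then show ?thesis
    by (simp only: fps_extend_mult[OF calgebra_hom_tensor_assoc] UA B BV A Phi)
qed

end
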